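(* Let $n\ge 2$, let $P\subset\mathbb{R}^n$ be a polytope with nonempty interior, and let $F=\{u_1,\ldots,u_n\}$ be a best frame for $P$. Then at least $n-1$ of the vectors $u_i$ are parallel to a facet of $P$ (that is, for at least $n-1$ indices $i$ there is a facet of $P$, possibly depending on $i$, whose normal vector is orthogonal to $u_i$).
   Context: A frame is an orthonormal basis $F=\{u_1,\ldots,u_n\}$ of $\mathbb{R}^n$. For a convex body $K\subset\mathbb{R}^n$ (compact, convex, nonempty interior), $K|u^\perp$ denotes the orthogonal projection of $K$ onto the hyperplane $u^\perp$ through the origin perpendicular to $u$. Put $\Psi(K;F)=\prod_{i=1}^n \mathrm{vol}_{n-1}(K|u_i^\perp)$. A best frame for $K$ is a frame $F$ minimizing $\Psi(K;F)$ among all frames of $\mathbb{R}^n$. *)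

theory Defs
  imports "HOL-Analysis.Analysis"
begin

definition orthonormal_basis :: "'a::euclidean_space set \<Rightarrow> 'a set \<Rightarrow> bool" where
  "orthonormal_basis S B \<longleftrightarrow>
     B \<subseteq> S \<and> pairwise orthogonal B \<and> (\<forall>b\<in>B. norm b = 1) \<and> span B = S"

lemma orthonormal_basis_exists:
  assumes "subspace S"
  shows "\<exists>B. orthonormal_basis S B"
  unfolding orthonormal_basis_def using orthonormal_basis_subspace[OF assms] by metis

lemma orthonormal_basis_finite_card:
  assumes "orthonormal_basis S B"
  shows "finite B" and "card B = dim S"
proof -
  have "0 \<notin> B" and "pairwise orthogonal B"
    using assms by (auto simp: orthonormal_basis_def)
  then have ind: "independent B"
    by (simp add: pairwise_orthogonal_independent)
  then show "finite B"
    by (simp add: independent_imp_finite)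
  show "card B = dim S"
    using assms ind dim_span_eq_card_independent by (fastforce simp: orthonormal_basis_def)
qed

text \<open>The volume of \<open>A \<subseteq> S\<close> of dimension \<open>dim S\<close>: Lebesgue measure on the subspace \<open>S\<close>,
  obtained by identifying \<open>S\<close> with a Euclidean coordinate space by means of an orthonormal basis
  of \<open>S\<close>. Which basis is chosen is irrelevant, since two orthonormal coordinate systems of \<open>S\<close>
  differ by an orthogonal transformation.\<close>

definition subspace_volume :: "'a::euclidean_space set \<Rightarrow> 'a set \<Rightarrow> real" where
  "subspace_volume S A =
     (let B = (SOME B. orthonormal_basis S B)
      in measure (Pi\<^sub>M B (\<lambda>_. lborel :: real measure)) ((\<lambda>x. \<lambda>b\<in>B. x \<bullet> b) ` A))"

definition perp_hyperplane :: "'a::euclidean_space \<Rightarrow> 'a set" where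
  "perp_hyperplane u = {x. u \<bullet> x = 0}"

definition perp_projection :: "'a::euclidean_space \<Rightarrow> 'a \<Rightarrow> 'a" where
  "perp_projection u x = x - ((x \<bullet> u) / (u \<bullet> u)) *\<^sub>R u"

definition projection_volume :: "'a::euclidean_space set \<Rightarrow> 'a \<Rightarrow> real" where
  "projection_volume K u = subspace_volume (perp_hyperplane u) (perp_projection u ` K)"

definition frame :: "'a::euclidean_space set \<Rightarrow> bool" where
  "frame F \<longleftrightarrow> orthonormal_basis UNIV F"

definition Psi :: "'a::euclidean_space set \<Rightarrow> 'a set \<Rightarrow> real" where
  "Psi K F = (\<Prod>u\<in>F. projection_volume K u)"

definition best_frame :: "'a::euclidean_space set \<Rightarrow> 'a set \<Rightarrow> bool" where
  "best_frame K F \<longleftrightarrow> frame F \<and> (\<forall>G. frame G \<longrightarrow> Psi K F \<le> Psi K G)"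

text \<open>A facet of a body with nonempty interior spans a hyperplane, so its normal vectors are
  determined up to nonzero scalar multiples.\<close>

definition normal_vector_of :: "'a::euclidean_space \<Rightarrow> 'a set \<Rightarrow> bool" where
  "normal_vector_of a f \<longleftrightarrow> a \<noteq> 0 \<and> (\<exists>c. affine hull f = {x. a \<bullet> x = c})"

definition parallel_to_facet_of :: "'a::euclidean_space \<Rightarrow> 'a set \<Rightarrow> bool" where
  "parallel_to_facet_of u P \<longleftrightarrow>
     (\<exists>f a. f facet_of P \<and> normal_vector_of a f \<and> orthogonal a u)"

end

theory Submission
  imports Defs
begin

text \<open>The shadow of \<open>P\<close> in direction \<open>u\<close> is, up to null sets, the disjoint union of the shadows of the
  facets whose outer unit normal \<open>a\<close> satisfies \<open>a \<bullet> u > 0\<close>, and the shadow of such a facet \<open>f\<close> has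
  volume \<open>vol f \<sqdot> (a \<bullet> u)\<close>. So if \<open>u\<close> is parallel to no facet, the projection volume \<open>h\<close> agrees with a
  linear functional on the unit vectors near \<open>u\<close>. Suppose that two vectors \<open>u\<close>, \<open>v\<close> of a best frame are
  both parallel to no facet, and rotate them in their plane by a small angle \<open>t\<close>. Then \<open>h\<close> takes the
  values \<open>A cos t + B sin t\<close> and \<open>C cos t + D sin t\<close> on the rotated vectors, with \<open>A = h u > 0\<close> and
  \<open>C = h v > 0\<close>. If the product of these has a local minimum at \<open>0\<close>, then \<open>A D + B C = 0\<close> and
  \<open>B D \<ge> A C > 0\<close>, but the former gives \<open>A C B D = - (A D)\<^sup>2 \<le> 0\<close>.\<close>

subsection \<open>Lebesgue measure and linear maps\<close>

text \<open>For a unit vector \<open>a\<close>, conjugation by an orthogonal map that carries a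
  coordinate axis to \<open>a\<close> yields a matrix differing from the identity in a single
  column. A general \<open>a\<close> is normalised by moving its length into
  \<open>w\<close>.\<close>

lemma det_rank_one_perturbation:
  fixes a w :: "real^'n"
  shows "det (matrix (\<lambda>x. x + (a \<bullet> x) *\<^sub>R w)) = 1 + a \<bullet> w"
proof -
  have unit: "det (matrix (\<lambda>x. x + (e \<bullet> x) *\<^sub>R v)) = 1 + e \<bullet> v" if e: "norm e = 1" for e v :: "real^'n"
  proof -
    obtain k :: 'n where True by simp
    obtain T :: "real^'n \<Rightarrow> real^'n" where T: "orthogonal_transformation T" and Tk: "T (axis k 1) = e"
      using orthogonal_transformation_exists_1[OF norm_axis_1 e] by metis
    define L where "L x = x + (x $ k) *\<^sub>R inv T v" for x :: "real^'n"
    have lin: "linear T" "linear (inv T)" "linear L"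
      using T orthogonal_transformation_inv[OF T]
      by (auto simp: orthogonal_transformation_linear L_def[abs_def] algebra_simps
          intro!: linearI)
    have TT: "T (inv T x) = x" "inv T (T x) = x" for x
      using orthogonal_transformation_bij[OF T]
      by (simp_all add: bij_is_surj surj_f_inv_f bij_is_inj)
    have coord: "inv T x $ k = e \<bullet> x" for x
    proof -
      have "inv T x $ k = axis k 1 \<bullet> inv T x" by (simp add: inner_axis')
      also have "\<dots> = T (axis k 1) \<bullet> T (inv T x)"
        using T by (simp add: orthogonal_transformation_def)
      finally show ?thesis by (simp add: Tk TT)
    qed
    have eq: "(\<lambda>x. x + (e \<bullet> x) *\<^sub>R v) = T \<circ> L \<circ> inv T"
      using lin by (auto simp: L_def fun_eq_iff TT coord linear_add linear_cmul)
    have "det (matrix (\<lambda>x. x + (e \<bullet> x) *\<^sub>R v)) = det (matrix T) * det (matrix L) * det (matrix (inv T))"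
      unfolding eq using lin by (simp add: matrix_compose linear_compose det_mul)
    also have "\<dots> = det (matrix L) * det (matrix (T \<circ> inv T))"
      using lin by (simp add: matrix_compose det_mul)
    also have "T \<circ> inv T = id" using TT by auto
    \<comment> \<open>Only column \<open>k\<close> of the identity is replaced, so Cramer's rule for
      the identity matrix gives the determinant as the \<open>k\<close>-th entry of the new
      column.\<close>
    also have "matrix L = (\<chi> i j. if j = k then (axis k 1 + inv T v) $ i else mat 1 $ i $ j)"
      by (auto simp: matrix_def L_def vec_eq_iff axis_def mat_def)
    also have "det \<dots> = 1 + e \<bullet> v"
      using cramer_lemma[of k "mat 1" "axis k 1 + inv T v"]
      unfolding matrix_vector_mul_lid by (simp add: coord)
    finally show ?thesis by (simp add: matrix_id[unfolded id_def] id_def)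
  qed
  show ?thesis
  proof (cases "a = 0")
    case True
    then show ?thesis using matrix_id by (simp add: id_def)
  next
    case False
    then have "det (matrix (\<lambda>x. x + ((a /\<^sub>R norm a) \<bullet> x) *\<^sub>R (norm a *\<^sub>R w))) = 1 + a \<bullet> w"
      by (subst unit) auto
    moreover have "((a /\<^sub>R norm a) \<bullet> x) *\<^sub>R (norm a *\<^sub>R w) = (a \<bullet> x) *\<^sub>R w" for x
      using False by simp
    ultimately show ?thesis by (simp only:)
  qed
qed

text \<open>The library proves the change of variables formula for linear maps only on \<open>real ^ 'n\<close> with a
  well-ordered index type \<open>'n\<close>. The type \<open>'a basis_index\<close> is a well-ordered copy of the basis of
  \<open>'a\<close>, which makes the formula available on every Euclidean space.\<close>

typedef (overloaded) 'a basis_index = "Basis :: 'a::euclidean_space set"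
  using nonempty_Basis by blast

instantiation basis_index :: (euclidean_space) "{finite, wellorder}"
begin

text \<open>The order is pulled back from the naturals along an injective enumeration of the basis,
  so well-founded induction is induction on that number.\<close>

definition "i \<le> j \<longleftrightarrow> to_nat_on Basis (Rep_basis_index i) \<le> to_nat_on Basis (Rep_basis_index j)"
definition "i < j \<longleftrightarrow> to_nat_on Basis (Rep_basis_index i) < to_nat_on Basis (Rep_basis_index j)"

instance
proof
  fix i j k :: "'a basis_index"
  show "(i < j) = (i \<le> j \<and> \<not> j \<le> i)" "i \<le> i" "i \<le> j \<Longrightarrow> j \<le> k \<Longrightarrow> i \<le> k" "i \<le> j \<or> j \<le> i"
    by (auto simp: less_eq_basis_index_def less_basis_index_def)
  show "i = j" if "i \<le> j" "j \<le> i"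
    using that Rep_basis_index[of i] Rep_basis_index[of j]
      inj_on_to_nat_on[OF countable_finite[OF finite_Basis]]
    by (auto simp: less_eq_basis_index_def Rep_basis_index_inject[symmetric] inj_on_def)
  show "P i" if "\<And>x. (\<And>y. y < x \<Longrightarrow> P y) \<Longrightarrow> P x" for P
    using that unfolding less_basis_index_def
    by (rule measure_induct_rule[where f = "\<lambda>i. to_nat_on Basis (Rep_basis_index i)"])
next
  have "(UNIV :: 'a basis_index set) = Abs_basis_index ` Basis"
    by (metis Abs_basis_index_cases UNIV_eq_I image_eqI)
  then show "finite (UNIV :: 'a basis_index set)"
    by (metis finite_Basis finite_imageI)
qed

end

section \<open>Transfer of Lebesgue measure to coordinate vectors\<close>

definition to_vec :: "'a::euclidean_space \<Rightarrow> real ^ 'a basis_index" where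
  "to_vec x = (\<chi> i. x \<bullet> Rep_basis_index i)"

definition of_vec :: "real ^ 'a basis_index \<Rightarrow> 'a::euclidean_space" where
  "of_vec v = (\<Sum>b\<in>Basis. (v $ Abs_basis_index b) *\<^sub>R b)"

lemma bij_betw_Rep_basis_index: "bij_betw Rep_basis_index UNIV Basis"
  by (auto simp: bij_betw_def inj_on_def Rep_basis_index_inject Rep_basis_index
      intro: Rep_basis_index_cases)

lemma of_vec_inner_Basis: "b \<in> Basis \<Longrightarrow> of_vec v \<bullet> b = v $ Abs_basis_index b"
  by (simp add: of_vec_def)

lemma of_vec_inner: "of_vec v \<bullet> Rep_basis_index i = v $ i"
  by (simp add: of_vec_def Rep_basis_index Rep_basis_index_inverse)

lemma to_vec_of_vec [simp]: "to_vec (of_vec v) = v"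
  by (simp add: to_vec_def of_vec_inner vec_eq_iff)

lemma of_vec_to_vec [simp]: "of_vec (to_vec x) = x"
  by (simp add: of_vec_def to_vec_def Abs_basis_index_inverse euclidean_representation cong: sum.cong)

lemma to_vec_inner: "to_vec x \<bullet> to_vec y = x \<bullet> y"
  unfolding inner_vec_def euclidean_inner[of x y] to_vec_def
  using sum.reindex_bij_betw[OF bij_betw_Rep_basis_index, of "\<lambda>b. (x \<bullet> b) * (y \<bullet> b)"] by simp

lemma of_vec_inner_of_vec: "of_vec v \<bullet> of_vec w = v \<bullet> w"
  by (metis to_vec_inner to_vec_of_vec)

lemma linear_to_vec: "linear to_vec" and linear_of_vec: "linear of_vec"
  by (auto intro!: linearI simp: to_vec_def of_vec_def vec_eq_iff algebra_simps sum.distrib scaleR_sum_right)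

lemma borel_measurable_linear:
  fixes f :: "'a::euclidean_space \<Rightarrow> 'b::euclidean_space"
  shows "linear f \<Longrightarrow> f \<in> borel_measurable borel"
  by (intro borel_measurable_continuous_onI linear_continuous_on linear_conv_bounded_linear[THEN iffD1])

text \<open>Lebesgue measure is determined by its values on boxes, and \<open>to_vec\<close> pulls a
  box back to a box with the same side lengths.\<close>

lemma distr_lborel_to_vec:
  "distr lborel borel (to_vec :: 'a::euclidean_space \<Rightarrow> _) = lborel"
proof (rule lborel_eqI[symmetric])
  fix l u :: "real ^ 'a basis_index"
  assume lu: "\<And>b. b \<in> Basis \<Longrightarrow> l \<bullet> b \<le> u \<bullet> b"
  then have lu': "l $ i \<le> u $ i" for i
    using axis_in_Basis_iff[of i 1] by (auto simp: cart_eq_inner_axis)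
  have all: "(\<forall>b\<in>Basis. P b) \<longleftrightarrow> (\<forall>i. P (Rep_basis_index i))" for P :: "'a \<Rightarrow> bool"
    by (metis Rep_basis_index Rep_basis_index_cases)
  have eq: "to_vec -` box l u = box (of_vec l :: 'a) (of_vec u)"
    by (auto simp: mem_box_cart mem_box all of_vec_inner to_vec_def)
  have "emeasure (distr lborel borel to_vec) (box l u) = emeasure lborel (box (of_vec l :: 'a) (of_vec u))"
    by (subst emeasure_distr) (auto simp: eq intro!: borel_measurable_linear linear_to_vec)
  also have "\<dots> = (\<Prod>b\<in>Basis. (of_vec u - of_vec l :: 'a) \<bullet> b)"
    using lu' by (subst emeasure_lborel_box) (simp_all add: of_vec_inner_Basis)
  also have "(\<Prod>b\<in>Basis. (of_vec u - of_vec l :: 'a) \<bullet> b) = (\<Prod>i\<in>UNIV. (u - l) $ i)"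
    by (subst prod.reindex_bij_betw[OF bij_betw_Rep_basis_index, symmetric])
      (simp add: inner_diff_left of_vec_inner)
  also have "\<dots> = (\<Prod>b\<in>Basis. (u - l) \<bullet> b)"
    by (subst prod.reindex_bij_betw[of "\<lambda>i. axis i 1" UNIV Basis, symmetric])
      (auto simp: cart_eq_inner_axis bij_betw_def inj_on_def axis_eq_axis Basis_vec_def)
  finally show "emeasure (distr lborel borel (to_vec :: 'a \<Rightarrow> _)) (box l u) = ennreal (\<Prod>b\<in>Basis. (u - l) \<bullet> b)" .
qed simp

lemma emeasure_to_vec_image:
  assumes "S \<in> sets borel"
  shows "to_vec ` S \<in> sets borel" "emeasure lborel (to_vec ` S) = emeasure lborel S"
proof -
  have eq: "to_vec ` S = of_vec -` S"
    by (auto simp: image_iff) (metis to_vec_of_vec)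
  show *: "to_vec ` S \<in> sets borel"
    unfolding eq using measurable_sets[OF borel_measurable_linear[OF linear_of_vec] assms] by simp
  have "emeasure lborel (to_vec ` S) = emeasure (distr lborel borel to_vec) (to_vec ` S)"
    by (simp add: distr_lborel_to_vec)
  also have "\<dots> = emeasure lborel (to_vec -` to_vec ` S)"
    using * by (subst emeasure_distr) (auto intro!: borel_measurable_linear linear_to_vec)
  also have "to_vec -` to_vec ` S = S"
    by auto (metis of_vec_to_vec)
  finally show "emeasure lborel (to_vec ` S) = emeasure lborel S" .
qed

text \<open>The measure-preserving map \<open>to_vec\<close> conjugates \<open>f\<close> to an
  endomorphism of \<open>real ^ 'a basis_index\<close>, where the determinant formula applies.
  Measurability of the image is a hypothesis because a singular \<open>f\<close> can destroy
  it.\<close>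

lemma emeasure_linear_image:
  fixes f :: "'a::euclidean_space \<Rightarrow> 'a"
  assumes f: "linear f" and S: "S \<in> sets borel" "emeasure lborel S < \<infinity>" and fS: "f ` S \<in> sets borel"
  shows "emeasure lborel (f ` S) = \<bar>det (matrix (to_vec \<circ> f \<circ> of_vec))\<bar> * emeasure lborel S"
proof -
  let ?g = "to_vec \<circ> f \<circ> of_vec"
  have lin: "linear ?g"
    by (intro linear_compose f linear_to_vec linear_of_vec)
  have S': "to_vec ` S \<in> lmeasurable"
    using S emeasure_to_vec_image[of S] by (auto simp: fmeasurable_def)
  have eq: "?g ` to_vec ` S = to_vec ` f ` S"
    by (force simp: image_comp)
  have "emeasure lborel (f ` S) = emeasure lebesgue (?g ` to_vec ` S)"
    unfolding eq using fS emeasure_to_vec_image[of "f ` S"] by simp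
  also have "\<dots> = ennreal (measure lebesgue (?g ` to_vec ` S))"
    using measurable_linear_image[OF lin S'] by (rule emeasure_eq_measure2)
  also have "\<dots> = \<bar>det (matrix ?g)\<bar> * emeasure lebesgue (to_vec ` S)"
    unfolding measure_linear_image[OF lin S'] emeasure_eq_measure2[OF S'] by (simp add: ennreal_mult)
  also have "emeasure lebesgue (to_vec ` S) = emeasure lborel S"
    using S emeasure_to_vec_image[of S] by simp
  finally show ?thesis .
qed

section \<open>Lebesgue measure in orthonormal coordinates\<close>

text \<open>The preimage of a box is its image under \<open>inv T\<close>, whose coordinate matrix
  has determinant of absolute value 1.\<close>

lemma distr_lborel_orthogonal:
  fixes T :: "'a::euclidean_space \<Rightarrow> 'a"
  assumes T: "orthogonal_transformation T"
  shows "distr lborel borel T = lborel"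
proof (rule lborel_eqI[symmetric])
  fix l u :: 'a
  assume lu: "\<And>b. b \<in> Basis \<Longrightarrow> l \<bullet> b \<le> u \<bullet> b"
  have [measurable]: "T \<in> borel_measurable borel"
    by (intro borel_measurable_linear orthogonal_transformation_linear T)
  have inv: "orthogonal_transformation (inv T)"
    using T by (rule orthogonal_transformation_inv)
  have eq: "T -` box l u = inv T ` box l u"
    using T by (intro bij_vimage_eq_inv_image orthogonal_transformation_bij)
  have "T -` box l u \<in> sets borel"
    using measurable_sets[OF \<open>T \<in> borel_measurable borel\<close>, of "box l u"] by simp
  then have b: "inv T ` box l u \<in> sets borel"
    by (simp add: eq)
  have "orthogonal_transformation (to_vec \<circ> inv T \<circ> of_vec)"
    using inv unfolding orthogonal_transformation_def
    by (simp add: to_vec_inner of_vec_inner_of_vec linear_compose linear_to_vec linear_of_vec)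
  then have det: "\<bar>det (matrix (to_vec \<circ> inv T \<circ> of_vec))\<bar> = 1"
    by (rule orthogonal_transformation_det)
  have "emeasure (distr lborel borel T) (box l u) = emeasure lborel (inv T ` box l u)"
    by (simp add: emeasure_distr eq)
  also have "\<dots> = emeasure lborel (box l u)"
    using lu b inv det by (subst emeasure_linear_image)
     (auto simp: orthogonal_transformation_linear emeasure_lborel_box_eq)
  also have "\<dots> = ennreal (\<Prod>b\<in>Basis. (u - l) \<bullet> b)"
    using lu by (simp add: emeasure_lborel_box)
  finally show "emeasure (distr lborel borel T) (box l u) = ennreal (\<Prod>b\<in>Basis. (u - l) \<bullet> b)" .
qed simp

lemma frameD:
  assumes "frame C"
  shows "finite C" "card C = DIM('a::euclidean_space)" "span C = UNIV"
    "\<And>b c. b \<in> C \<Longrightarrow> c \<in> C \<Longrightarrow> b \<bullet> c = (if b = (c::'a) then 1 else 0)"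
proof -
  show "finite C" "card C = DIM('a)" "span C = UNIV"
    using assms orthonormal_basis_finite_card[of UNIV C]
    by (auto simp: frame_def orthonormal_basis_def)
  show "b \<bullet> c = (if b = c then 1 else 0)" if "b \<in> C" "c \<in> C" for b c
    using assms that
    by (auto simp: frame_def orthonormal_basis_def pairwise_def orthogonal_def norm_eq_1)
qed

text \<open>The coordinates of \<open>T x\<close> along \<open>C\<close> are the standard
  coordinates of \<open>x\<close> relabelled, where \<open>T\<close> is the orthogonal map carrying
  \<open>Basis\<close> to \<open>C\<close>. Since \<open>T\<close> preserves \<open>lborel\<close>,
  the product structure in standard coordinates carries over to \<open>C\<close>. This is the link
  to the product measure in \<open>subspace_volume\<close>.\<close>

lemma distr_lborel_frame_coordinates:
  fixes C :: "'a::euclidean_space set"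
  assumes C: "frame C"
  shows "distr lborel (Pi\<^sub>M C (\<lambda>_. lborel)) (\<lambda>x. \<lambda>b\<in>C. x \<bullet> b) = Pi\<^sub>M C (\<lambda>_. lborel)"
proof -
  note [simp] = frameD(1)[OF C]
  interpret product_sigma_finite "\<lambda>_::'a. lborel :: real measure" ..
  obtain p where p: "bij_betw p (Basis :: 'a set) C"
    using finite_same_card_bij[of "Basis :: 'a set" C] frameD(2)[OF C] by auto
  define q where "q = the_inv_into Basis p"
  have q: "q (p b) = b" if "b \<in> Basis" for b
    using p that by (simp add: q_def the_inv_into_f_f bij_betw_def)
  have qp: "q c \<in> Basis" "p (q c) = c" if "c \<in> C" for c
    using p that by (auto simp: q_def bij_betw_def the_inv_into_into f_the_inv_into_f)
  define T where "T x = (\<Sum>b\<in>Basis. (x \<bullet> b) *\<^sub>R p b)" for x :: 'a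
  have pp: "p b \<bullet> p c = (if b = c then 1 else 0)" if "b \<in> Basis" "c \<in> Basis" for b c
    using frameD(4)[OF C] p that unfolding bij_betw_def inj_on_def by (metis imageI)
  have Tp: "T x \<bullet> p b = x \<bullet> b" if "b \<in> Basis" for x b
    using that by (simp add: T_def inner_sum_left pp if_distrib[of "(*) _"] sum.delta cong: if_cong)
  have Tq: "T x \<bullet> c = x \<bullet> q c" if "c \<in> C" for x c
    using Tp[of "q c" x] qp[OF that] by simp
  have "T x \<bullet> T y = x \<bullet> y" for x y
  proof -
    have "T x \<bullet> T y = (\<Sum>b\<in>Basis. (y \<bullet> b) * (T x \<bullet> p b))"
      by (subst (2) T_def) (simp add: inner_sum_right)
    also have "\<dots> = x \<bullet> y"
      by (subst euclidean_inner[of x y]) (simp add: Tp mult.commute)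
    finally show ?thesis .
  qed
  moreover have lin: "linear T"
    unfolding T_def by (intro linear_compose_sum ballI bounded_linear.linear bounded_linear_intros)
  ultimately have T: "orthogonal_transformation T"
    by (simp add: orthogonal_transformation_def)
  have [measurable]: "T \<in> borel_measurable borel"
    using lin by (rule borel_measurable_linear)
  have [measurable]: "(\<lambda>x::'a. \<lambda>b\<in>C. x \<bullet> b) \<in> measurable borel (Pi\<^sub>M C (\<lambda>_. lborel))"
    by (intro measurable_restrict) simp
  show ?thesis
  proof (rule PiM_eqI)
    fix A assume A: "\<And>c. c \<in> C \<Longrightarrow> A c \<in> sets (lborel :: real measure)"
    have [measurable]: "A (p b) \<in> sets borel" if "b \<in> Basis" for b
      using A[of "p b"] p that by (auto simp: bij_betw_def)
    have [measurable]: "Pi\<^sub>E C A \<in> sets (Pi\<^sub>M C (\<lambda>_. lborel))"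
      using A by (intro sets_PiM_I_finite) auto
    \<comment> \<open>Invariance of \<open>lborel\<close> under \<open>T\<close> allows
      \<open>x\<close> to be replaced by \<open>T x\<close> in the coordinate map.\<close>
    have "emeasure (distr lborel (Pi\<^sub>M C (\<lambda>_. lborel)) (\<lambda>x. \<lambda>b\<in>C. x \<bullet> b)) (Pi\<^sub>E C A) =
      emeasure (distr (distr lborel borel T) (Pi\<^sub>M C (\<lambda>_. lborel)) (\<lambda>x. \<lambda>b\<in>C. x \<bullet> b)) (Pi\<^sub>E C A)"
      by (simp add: distr_lborel_orthogonal[OF T])
    also have "\<dots> = emeasure (distr lborel (Pi\<^sub>M C (\<lambda>_. lborel)) (\<lambda>x. \<lambda>b\<in>C. T x \<bullet> b)) (Pi\<^sub>E C A)"
      by (subst distr_distr) (auto simp: comp_def)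
    also have "\<dots> = emeasure lborel {x. \<forall>b\<in>Basis. x \<bullet> b \<in> A (p b)}"
    proof (subst emeasure_distr)
      show "(\<lambda>x. \<lambda>b\<in>C. T x \<bullet> b) \<in> measurable lborel (Pi\<^sub>M C (\<lambda>_. lborel))"
        by (intro measurable_restrict) simp
      have "(\<forall>c\<in>C. x \<bullet> q c \<in> A c) \<longleftrightarrow> (\<forall>b\<in>Basis. x \<bullet> b \<in> A (p b))" for x
        using p q by (force simp: bij_betw_def)
      then show "emeasure lborel ((\<lambda>x. \<lambda>b\<in>C. T x \<bullet> b) -` Pi\<^sub>E C A \<inter> space lborel) =
        emeasure lborel {x. \<forall>b\<in>Basis. x \<bullet> b \<in> A (p b)}"
        by (intro arg_cong[where f = "emeasure lborel"]) (auto simp: PiE_iff Tq)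
    qed simp
    also have "\<dots> = (\<integral>\<^sup>+x. indicator {x. \<forall>b\<in>Basis. x \<bullet> b \<in> A (p b)} x \<partial>lborel)"
      by (subst nn_integral_indicator) (auto intro!: pred_sets2)
    \<comment> \<open>The indicator factors over the standard coordinates, so its integral is a
      product of one-dimensional measures.\<close>
    also have "\<dots> = (\<integral>\<^sup>+x. (\<Prod>b\<in>Basis. indicator (A (p b)) (x \<bullet> b)) \<partial>lborel)"
      by (intro nn_integral_cong) (auto simp: indicator_def prod_zero_iff)
    also have "\<dots> = (\<Prod>b\<in>Basis. emeasure lborel (A (p b)))"
      by (subst nn_integral_lborel_prod) auto
    also have "\<dots> = (\<Prod>c\<in>C. emeasure lborel (A c))"
      using p by (rule prod.reindex_bij_betw)
    finally show "emeasure (distr lborel (Pi\<^sub>M C (\<lambda>_. lborel)) (\<lambda>x. \<lambda>b\<in>C. x \<bullet> b)) (Pi\<^sub>E C A) =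
       (\<Prod>c\<in>C. emeasure lborel (A c))" .
  qed simp_all
qed

text \<open>The factor is the determinant computed above. Compactness makes both the set and its
  image Borel, even if the map is singular.\<close>

lemma measure_rank_one_perturbation:
  fixes a w :: "'a::euclidean_space"
  assumes "compact S"
  shows "measure lebesgue ((\<lambda>x. x + (a \<bullet> x) *\<^sub>R w) ` S) = \<bar>1 + a \<bullet> w\<bar> * measure lebesgue S"
proof -
  let ?f = "\<lambda>x. x + (a \<bullet> x) *\<^sub>R w"
  have lin: "linear ?f"
    by (auto intro!: linearI simp: algebra_simps)
  have "compact (?f ` S)"
    by (intro compact_continuous_image assms continuous_intros)
  then have fS: "?f ` S \<in> sets borel" by (simp add: borel_compact)
  have S: "S \<in> sets borel" "emeasure lborel S < \<infinity>"
    using assms by (simp_all add: borel_compact emeasure_compact_finite[simplified])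
  have inner: "a \<bullet> of_vec v = to_vec a \<bullet> v" for v
    by (metis to_vec_inner to_vec_of_vec)
  have "to_vec \<circ> ?f \<circ> of_vec = (\<lambda>v. v + (to_vec a \<bullet> v) *\<^sub>R to_vec w)"
    by (auto simp: fun_eq_iff inner linear_add[OF linear_to_vec] linear_cmul[OF linear_to_vec])
  then have "det (matrix (to_vec \<circ> ?f \<circ> of_vec)) = 1 + a \<bullet> w"
    by (simp add: det_rank_one_perturbation to_vec_inner)
  then have "emeasure lborel (?f ` S) = \<bar>1 + a \<bullet> w\<bar> * emeasure lborel S"
    using emeasure_linear_image[OF lin S fS] by simp
  then show ?thesis
    using S fS by (simp add: measure_def enn2real_mult)
qed

subsection \<open>Projection volumes as volumes of prisms\<close>

text \<open>For a unit vector \<open>u\<close> this is the prism of height one over the shadow of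
  \<open>S\<close>. Its full-dimensional volume equals the volume of the shadow, so shadows in
  different directions can be compared within the single measure \<open>lebesgue\<close>.\<close>

definition prism :: "'a::euclidean_space \<Rightarrow> 'a set \<Rightarrow> 'a set" where
  "prism u S = (\<lambda>(x, s). perp_projection u x + s *\<^sub>R u) ` (S \<times> {0..1})"

lemma continuous_on_perp_projection [continuous_intros]:
  "continuous_on S f \<Longrightarrow> continuous_on S (\<lambda>x. perp_projection u (f x))"
  unfolding perp_projection_def by (cases "u = 0") (auto intro!: continuous_intros)

lemma compact_prism: "compact S \<Longrightarrow> compact (prism u S)"
  unfolding prism_def
  by (intro compact_continuous_image compact_Times) (auto intro!: continuous_intros simp: case_prod_unfold)

lemma inner_perp_projection [simp]: "perp_projection u x \<bullet> u = 0"
  by (simp add: perp_projection_def inner_diff_left)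

lemma perp_projection_perp_projection [simp]:
  "perp_projection u (perp_projection u x + s *\<^sub>R u) = perp_projection u x"
  by (simp add: perp_projection_def inner_diff_left inner_add_left algebra_simps)

lemma mem_prism_iff:
  assumes "norm u = 1"
  shows "z \<in> prism u S \<longleftrightarrow> (\<exists>x\<in>S. perp_projection u x = perp_projection u z) \<and> 0 \<le> z \<bullet> u \<and> z \<bullet> u \<le> 1"
proof -
  have "u \<bullet> u = 1" using assms by (simp add: norm_eq_1)
  then have "z = perp_projection u x + s *\<^sub>R u \<longleftrightarrow> perp_projection u x = perp_projection u z \<and> s = z \<bullet> u" for x s
    using inner_perp_projection[of u x] perp_projection_perp_projection[of u x s]
    by (auto simp: inner_add_left) (simp add: perp_projection_def)
  then show ?thesis
    by (auto simp: prism_def image_iff)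
qed

text \<open>A map of determinant \<open>a \<bullet> u\<close> tilts the axis of
  \<open>prism a S\<close> from \<open>a\<close> to \<open>u\<close>, a shear along \<open>u\<close>
  then flattens the base into the hyperplane orthogonal to \<open>u\<close>, and a translation
  finishes. As \<open>S\<close> lies in a hyperplane with unit normal \<open>a\<close>, the volume
  of \<open>prism a S\<close> is that of \<open>S\<close> itself.\<close>

lemma measure_prism_hyperplane:
  fixes a u :: "'a::euclidean_space"
  assumes S: "compact S" "S \<subseteq> {x. a \<bullet> x = b}" and a: "norm a = 1" and u: "norm u = 1" and au: "a \<bullet> u \<noteq> 0"
  shows "measure lebesgue (prism u S) = \<bar>a \<bullet> u\<bar> * measure lebesgue (prism a S)"
proof -
  have [simp]: "a \<bullet> a = 1" "u \<bullet> u = 1"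
    using a u by (simp_all add: norm_eq_1)
  \<comment> \<open>\<open>f\<close> fixes the hyperplane orthogonal to \<open>a\<close> and sends
    \<open>a\<close> to \<open>u\<close>.\<close>
  define f where "f z = z + (a \<bullet> z) *\<^sub>R (u - a)" for z
  \<comment> \<open>\<open>v\<close> is orthogonal to \<open>u\<close> and has the same inner
    product as \<open>u\<close> with every vector orthogonal to \<open>a\<close>. Hence
    \<open>g\<close> fixes \<open>u\<close> and acts as \<open>perp_projection u\<close> on the
    hyperplane orthogonal to \<open>a\<close>.\<close>
  define v where "v = u - (1 / (a \<bullet> u)) *\<^sub>R a"
  define g where "g z = z + (v \<bullet> z) *\<^sub>R (- u)" for z
  have f: "measure lebesgue (f ` T) = \<bar>a \<bullet> u\<bar> * measure lebesgue T" if "compact T" for T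
    unfolding f_def using measure_rank_one_perturbation[OF that, of a "u - a"]
    by (simp add: inner_diff_right)
  have g: "measure lebesgue (g ` T) = measure lebesgue T" if "compact T" for T
    unfolding g_def using measure_rank_one_perturbation[OF that, of v "- u"] au
    by (simp add: v_def inner_diff_left)
  have cf: "compact (f ` T)" if "compact T" for T
    unfolding f_def by (intro compact_continuous_image that continuous_intros)
  \<comment> \<open>The translation restores the offset \<open>b *\<^sub>R a\<close> by which
    \<open>x\<close> differs from \<open>perp_projection a x\<close>.\<close>
  have gf: "perp_projection u x + s *\<^sub>R u = b *\<^sub>R perp_projection u a + g (f (perp_projection a x + s *\<^sub>R a))"
    if "x \<in> S" for x s
  proof -
    have ax: "a \<bullet> x = b" using that S by auto
    have f': "f (perp_projection a x + s *\<^sub>R a) = x - b *\<^sub>R a + s *\<^sub>R u"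
      using ax by (simp add: f_def perp_projection_def inner_commute[of x a] algebra_simps)
    have v: "v \<bullet> (x - b *\<^sub>R a + s *\<^sub>R u) = u \<bullet> (x - b *\<^sub>R a)"
      using ax au by (simp add: v_def inner_diff_left inner_diff_right inner_add_right inner_commute[of u a] algebra_simps)
    then show ?thesis
      unfolding f' g_def v
      by (simp add: perp_projection_def algebra_simps inner_diff_right inner_commute)
  qed
  have "prism u S = (+) (b *\<^sub>R perp_projection u a) ` g ` f ` prism a S"
    unfolding prism_def image_comp
    by (intro image_cong) (auto simp: gf)
  then show ?thesis
    by (simp only: measure_translation f g cf compact_prism S)
qed

text \<open>Adding \<open>u\<close> to an orthonormal basis of its orthogonal hyperplane gives a
  frame. In its coordinates the prism is the shadow times the unit interval, and Fubini
  applies.\<close>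

lemma projection_volume_eq_measure_prism:
  fixes u :: "'a::euclidean_space"
  assumes u: "norm u = 1" and K: "compact K"
  shows "projection_volume K u = measure lebesgue (prism u K)"
proof -
  define H where "H = perp_hyperplane u"
  \<comment> \<open>This has to be the very basis chosen in \<open>subspace_volume\<close>, so that
    unfolding the definition gives the same product measure.\<close>
  define B where "B = (SOME B. orthonormal_basis H B)"
  have uu [simp]: "u \<bullet> u = 1" using u by (simp add: norm_eq_1)
  have "subspace H"
    unfolding H_def perp_hyperplane_def by (rule subspace_hyperplane)
  then have B: "orthonormal_basis H B"
    unfolding B_def by (rule someI_ex[OF orthonormal_basis_exists])
  have finB [simp]: "finite B"
    using B orthonormal_basis_finite_card by blast
  have uB: "u \<bullet> b = 0" if "b \<in> B" for b
    using B that by (auto simp: orthonormal_basis_def H_def perp_hyperplane_def)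
  then have [simp]: "u \<notin> B" by force
  have spanB: "span B = {x. u \<bullet> x = 0}"
    using B by (simp add: orthonormal_basis_def H_def perp_hyperplane_def)
  have spanC: "x \<in> span (insert u B)" for x
    unfolding span_insert spanB by (intro CollectI exI[of _ "u \<bullet> x"]) (simp add: inner_diff_right)
  have C: "frame (insert u B)"
    using B u uB spanC
    by (auto simp: frame_def orthonormal_basis_def pairwise_insert orthogonal_def inner_commute)
  have BB: "b \<bullet> c = (if b = c then 1 else 0)" if "b \<in> B" "c \<in> B" for b c
    using frameD(4)[OF C] that by auto
  have eqI: "x = y" if "u \<bullet> x = 0" "u \<bullet> y = 0" "\<And>b. b \<in> B \<Longrightarrow> x \<bullet> b = y \<bullet> b" for x y
  proof -
    have "x - y \<in> span B" using that by (simp add: spanB inner_diff_right)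
    then have "orthogonal (x - y) (x - y)"
      by (rule orthogonal_to_span) (use that in \<open>auto simp: orthogonal_def inner_diff_left\<close>)
    then show ?thesis by (simp add: orthogonal_def)
  qed
  interpret product_sigma_finite "\<lambda>_::'a. lborel :: real measure" ..
  let ?M = "\<lambda>I::'a set. Pi\<^sub>M I (\<lambda>_. lborel :: real measure)"
  let ?P = "perp_projection u ` K"
  define A where "A = (\<lambda>x. \<lambda>b\<in>B. x \<bullet> b) ` ?P"
  have P: "u \<bullet> x = 0" if "x \<in> ?P" for x
    using that by (auto simp: perp_projection_def inner_diff_right inner_commute)
  have comb: "(\<Sum>c\<in>B. f c *\<^sub>R c) \<bullet> b = f b" if "b \<in> B" for f b
    using that by (simp add: inner_sum_left BB if_distrib[of "(*) _"] cong: if_cong)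
  have ucomb: "u \<bullet> (\<Sum>c\<in>B. f c *\<^sub>R c) = 0" for f
    by (simp add: inner_sum_right uB)
  \<comment> \<open>Writing the image \<open>A\<close> as a preimage under the inverse coordinate
    map makes it measurable.\<close>
  have Aeq: "A = (\<lambda>f. \<Sum>b\<in>B. f b *\<^sub>R b) -` ?P \<inter> space (?M B)"
  proof (intro equalityI subsetI)
    fix f assume "f \<in> A"
    then obtain x where x: "x \<in> ?P" "f = (\<lambda>b\<in>B. x \<bullet> b)" by (auto simp: A_def)
    have "(\<Sum>b\<in>B. f b *\<^sub>R b) = x"
      by (rule eqI) (use x P in \<open>simp_all add: comb ucomb\<close>)
    with x show "f \<in> (\<lambda>f. \<Sum>b\<in>B. f b *\<^sub>R b) -` ?P \<inter> space (?M B)"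
      by (auto simp: space_PiM)
  next
    fix f assume f: "f \<in> (\<lambda>f. \<Sum>b\<in>B. f b *\<^sub>R b) -` ?P \<inter> space (?M B)"
    then have "f = (\<lambda>b\<in>B. (\<Sum>b\<in>B. f b *\<^sub>R b) \<bullet> b)"
      by (auto simp: fun_eq_iff comb space_PiM PiE_def extensional_def)
    with f show "f \<in> A" by (auto simp: A_def)
  qed
  have "compact ?P"
    using K by (intro compact_continuous_image continuous_intros)
  then have [measurable]: "?P \<in> sets borel" by (rule borel_compact)
  have "(\<lambda>f. \<Sum>b\<in>B. f b *\<^sub>R b) \<in> measurable (?M B) borel"
    by (intro borel_measurable_sum borel_measurable_scaleR) measurable
  then have A [measurable]: "A \<in> sets (?M B)"
    unfolding Aeq by (rule measurable_sets) simp
  let ?C = "insert u B"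
  define E where "E = {f \<in> space (?M ?C). restrict f B \<in> A \<and> f u \<in> {0..1}}"
  have "(\<lambda>f. restrict f B) \<in> measurable (?M ?C) (?M B)"
    by (rule measurable_restrict_subset) auto
  then have E [measurable]: "E \<in> sets (?M ?C)"
    unfolding E_def by measurable
  have prism: "prism u K = (\<lambda>x. \<lambda>b\<in>?C. x \<bullet> b) -` E"
  proof -
    have "(\<exists>x\<in>K. perp_projection u x = perp_projection u z) \<longleftrightarrow> (\<lambda>b\<in>B. z \<bullet> b) \<in> A" for z
    proof -
      have "perp_projection u x = perp_projection u z \<longleftrightarrow> (\<lambda>b\<in>B. z \<bullet> b) = (\<lambda>b\<in>B. perp_projection u x \<bullet> b)" for x
      proof
        assume "perp_projection u x = perp_projection u z"
        then show "(\<lambda>b\<in>B. z \<bullet> b) = (\<lambda>b\<in>B. perp_projection u x \<bullet> b)"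
          by (auto simp: fun_eq_iff restrict_def perp_projection_def inner_diff_left uB)
      next
        assume r: "(\<lambda>b\<in>B. z \<bullet> b) = (\<lambda>b\<in>B. perp_projection u x \<bullet> b)"
        show "perp_projection u x = perp_projection u z"
        proof (rule eqI)
          fix b assume "b \<in> B"
          then have "z \<bullet> b = perp_projection u x \<bullet> b" using fun_cong[OF r, of b] by simp
          then show "perp_projection u x \<bullet> b = perp_projection u z \<bullet> b"
            using \<open>b \<in> B\<close> by (simp add: perp_projection_def inner_diff_left uB)
        qed (simp_all add: perp_projection_def inner_diff_right inner_commute)
      qed
      then show ?thesis by (auto simp: A_def)
    qed
    moreover have "restrict (\<lambda>b\<in>?C. z \<bullet> b) B = (\<lambda>b\<in>B. z \<bullet> b)" for z :: 'a
      by (auto simp: restrict_def)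
    ultimately show ?thesis
      using u by (auto simp: E_def space_PiM mem_prism_iff)
  qed
  have "emeasure lborel (prism u K) = emeasure (distr lborel (?M ?C) (\<lambda>x. \<lambda>b\<in>?C. x \<bullet> b)) E"
    by (subst emeasure_distr) (auto simp: prism intro!: measurable_restrict)
  also have "\<dots> = emeasure (?M ?C) E"
    by (simp only: distr_lborel_frame_coordinates[OF C])
  also have "\<dots> = (\<integral>\<^sup>+f. indicator E f \<partial>?M ?C)"
    by simp
  \<comment> \<open>Fubini splits off the coordinate along \<open>u\<close>, which contributes the
    length 1 of the interval.\<close>
  also have "\<dots> = (\<integral>\<^sup>+f. (\<integral>\<^sup>+y. indicator E (f(u := y)) \<partial>lborel) \<partial>?M B)"
    by (rule product_nn_integral_insert) auto
  also have "\<dots> = (\<integral>\<^sup>+f. (\<integral>\<^sup>+y. indicator A f * indicator {0..1::real} y \<partial>lborel) \<partial>?M B)"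
  proof (rule nn_integral_cong, rule nn_integral_cong)
    fix f y
    assume f: "f \<in> space (?M B)"
    then have "restrict (f(u := y)) B = f"
      by (auto simp: fun_eq_iff space_PiM PiE_def extensional_def)
    moreover have "f(u := y) \<in> space (?M ?C)"
      using f by (auto simp: space_PiM PiE_def extensional_def)
    ultimately show "indicator E (f(u := y)) = (indicator A f * indicator {0..1} y :: ennreal)"
      by (auto simp: E_def indicator_def)
  qed
  also have "\<dots> = emeasure (?M B) A"
    by (simp add: nn_integral_cmult)
  finally have "emeasure (?M B) A = emeasure lborel (prism u K)" ..
  moreover have "projection_volume K u = measure (?M B) A"
    by (simp add: projection_volume_def subspace_volume_def A_def B_def H_def Let_def)
  ultimately show ?thesis
    using borel_compact[OF compact_prism[OF K, of u]] by (simp add: measure_def)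
qed

text \<open>A ball inside \<open>K\<close> casts a shadow over which the prism contains a ball. This
  yields the positive values that the rotation argument needs.\<close>

lemma measure_prism_pos:
  fixes u :: "'a::euclidean_space"
  assumes u: "norm u = 1" and K: "compact K" "interior K \<noteq> {}"
  shows "0 < measure lebesgue (prism u K)"
proof -
  have [simp]: "u \<bullet> u = 1" using u by (simp add: norm_eq_1)
  obtain x e where e: "e > 0" "ball x e \<subseteq> K"
    using K(2) by (meson all_not_in_conv mem_interior)
  \<comment> \<open>The centre sits at half the height of the prism, so a radius of at most 1/2
    keeps the ball between its two bases.\<close>
  define c where "c = perp_projection u x + (1/2) *\<^sub>R u"
  have "ball c (min e (1/2)) \<subseteq> prism u K"
  proof
    fix z assume "z \<in> ball c (min e (1/2))"
    then have z: "norm (z - c) < e" "norm (z - c) < 1/2"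
      by (simp_all add: dist_norm norm_minus_commute)
    have "\<bar>(z - c) \<bullet> u\<bar> \<le> norm (z - c)"
      using Cauchy_Schwarz_ineq2[of "z - c" u] u by simp
    moreover have "c \<bullet> u = 1/2"
      by (simp add: c_def perp_projection_def inner_add_left inner_diff_left)
    ultimately have "0 \<le> z \<bullet> u \<and> z \<bullet> u \<le> 1"
      using z(2) by (auto simp: inner_diff_left)
    moreover have "x + (z - c) \<in> K"
      using e(2) z(1) by (auto simp: dist_norm norm_minus_commute intro!: subsetD[OF e(2)])
    moreover have "perp_projection u (x + (z - c)) = perp_projection u z"
      by (simp add: c_def perp_projection_def inner_add_left inner_diff_left algebra_simps)
    ultimately show "z \<in> prism u K"
      using u by (auto simp: mem_prism_iff)
  qed
  then have "measure lebesgue (ball c (min e (1/2))) \<le> measure lebesgue (prism u K)"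
    by (intro measure_mono_fmeasurable) (auto simp: compact_prism K lmeasurable_compact)
  moreover have "0 < measure lebesgue (ball c (min e (1/2)))"
    using e(1) content_ball_pos[of "min e (1/2)" c] by simp
  ultimately show ?thesis by linarith
qed

subsection \<open>Projections of polytopes\<close>

text \<open>In a minimal description by half-spaces every bounding hyperplane cuts out a facet.
  Nonempty interior makes the affine hull the whole space, and dividing by the norm makes the
  normals unit vectors.\<close>

lemma polytope_facet_inequalities:
  fixes P :: "'a::euclidean_space set"
  assumes P: "polytope P" "interior P \<noteq> {}"
  obtains I :: "('a \<times> real) set" where "finite I" "\<forall>(a, b)\<in>I. norm a = 1"
    "P = {x. \<forall>(a, b)\<in>I. a \<bullet> x \<le> b}" "\<forall>(a, b)\<in>I. P \<inter> {x. a \<bullet> x = b} facet_of P"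
proof -
  have hull: "affine hull P = UNIV"
    using P(2) by (rule affine_hull_nonempty_interior)
  obtain F where F: "finite F" "P = affine hull P \<inter> \<Inter>F"
    "\<And>h. h \<in> F \<Longrightarrow> \<exists>a b. a \<noteq> 0 \<and> h = {x. a \<bullet> x \<le> b}"
    "\<And>F'. F' \<subset> F \<Longrightarrow> P \<subset> affine hull P \<inter> \<Inter>F'"
    using polytope_imp_polyhedron[OF P(1)] unfolding polyhedron_Int_affine_minimal by metis
  then obtain a b where ab: "\<And>h. h \<in> F \<Longrightarrow> a h \<noteq> 0 \<and> h = {x. a h \<bullet> x \<le> b h}"
    by metis
  define I where "I = (\<lambda>h. (a h /\<^sub>R norm (a h), b h / norm (a h))) ` F"
  show ?thesis
  proof
    show "finite I" using F(1) by (simp add: I_def)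
    show "\<forall>(a, b)\<in>I. norm a = 1"
      using ab by (auto simp: I_def)
    have le: "(a h /\<^sub>R norm (a h)) \<bullet> x \<le> b h / norm (a h) \<longleftrightarrow> a h \<bullet> x \<le> b h"
      and eq: "(a h /\<^sub>R norm (a h)) \<bullet> x = b h / norm (a h) \<longleftrightarrow> a h \<bullet> x = b h" if "h \<in> F" for h x
      using ab[OF that] by (auto simp: field_simps)
    have "P = \<Inter>F" using F(2) hull by simp
    also have "\<dots> = {x. \<forall>h\<in>F. a h \<bullet> x \<le> b h}"
      using ab by auto
    also have "\<dots> = {x. \<forall>(a, b)\<in>I. a \<bullet> x \<le> b}"
      by (simp add: I_def le del: inner_scaleR_left)
    finally show "P = {x. \<forall>(a, b)\<in>I. a \<bullet> x \<le> b}" .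
    show "\<forall>(a, b)\<in>I. P \<inter> {x. a \<bullet> x = b} facet_of P"
    proof clarify
      fix a' b' assume I: "(a', b') \<in> I"
      obtain h where h: "h \<in> F" "a' = a h /\<^sub>R norm (a h)" "b' = b h / norm (a h)"
        using I by (auto simp: I_def)
      have "P \<inter> {x. a h \<bullet> x = b h} facet_of P"
        using facet_of_polyhedron_explicit[OF F(1,2) ab F(4)] h(1) by blast
      then show "P \<inter> {x. a' \<bullet> x = b'} facet_of P"
        using eq[OF h(1)] unfolding h by (simp del: inner_scaleR_left)
    qed
  qed
qed

text \<open>Both sides are affine of dimension one less than the space, so the inclusion is an
  equality.\<close>

lemma affine_hull_facet_in_hyperplane:
  fixes P :: "'a::euclidean_space set"
  assumes "interior P \<noteq> {}" "f facet_of P" "f \<subseteq> {x. a \<bullet> x = b}" "a \<noteq> 0"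
  shows "affine hull f = {x. a \<bullet> x = b}"
proof (rule affine_dim_equal)
  show "affine hull f \<noteq> {}" using assms by (auto simp: facet_of_def)
  show "affine hull f \<subseteq> {x. a \<bullet> x = b}"
    using assms by (intro hull_minimal affine_hyperplane)
  have "aff_dim P = DIM('a)"
    using assms affine_hull_nonempty_interior aff_dim_eq_full by blast
  then show "aff_dim (affine hull f) = aff_dim {x. a \<bullet> x = b}"
    using assms by (simp add: facet_of_def aff_dim_hyperplane)
qed (auto simp: affine_hyperplane)

text \<open>Moving a point of the body as far as possible in direction \<open>u\<close> ends on a facet whose outer
  normal makes an acute angle with \<open>u\<close>.\<close>

lemma prism_polytope_eq_Union:
  fixes P :: "'a::euclidean_space set"
  assumes P: "compact P" "P = {x. \<forall>(a, b)\<in>I. a \<bullet> x \<le> b}" and I: "finite I" and u: "norm u = 1"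
  shows "prism u P = (\<Union>(a, b)\<in>{(a, b) \<in> I. 0 < a \<bullet> u}. prism u (P \<inter> {x. a \<bullet> x = b}))" (is "_ = ?R")
proof
  have uu [simp]: "u \<bullet> u = 1" using u by (simp add: norm_eq_1)
  show "?R \<subseteq> prism u P" by (auto simp: prism_def)
  show "prism u P \<subseteq> ?R"
  proof
    fix z assume z: "z \<in> prism u P"
    then obtain x where x: "x \<in> P" "perp_projection u x = perp_projection u z"
      using u by (auto simp: mem_prism_iff)
    \<comment> \<open>These are the points of \<open>P\<close> on the line through \<open>z\<close>
      in direction \<open>u\<close>; by compactness one of them, \<open>y\<close>, is furthest along
      \<open>u\<close>.\<close>
    let ?L = "P \<inter> {y. perp_projection u y = perp_projection u z}"
    have "closed {y. perp_projection u y = perp_projection u z}"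
      by (intro closed_Collect_eq continuous_intros)
    then have "compact ?L" using P(1) by (rule compact_Int_closed[rotated])
    moreover have "?L \<noteq> {}" using x by auto
    ultimately have "\<exists>y\<in>?L. \<forall>y'\<in>?L. y' \<bullet> u \<le> y \<bullet> u"
      by (intro continuous_attains_sup continuous_intros)
    then obtain y where y: "y \<in> ?L" "\<And>y'. y' \<in> ?L \<Longrightarrow> y' \<bullet> u \<le> y \<bullet> u"
      by blast
    have "\<exists>(a, b)\<in>I. 0 < a \<bullet> u \<and> a \<bullet> y = b"
    proof (rule ccontr)
      assume no: "\<not> ?thesis"
      \<comment> \<open>If no active constraint at \<open>y\<close> has a normal at an acute angle
        with \<open>u\<close>, then \<open>y\<close> can be moved further within \<open>P\<close>:
        constraints with \<open>0 < a \<bullet> u\<close> are strict at \<open>y\<close> and survive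
        by continuity, and the left side of the others does not increase.\<close>
      have "\<forall>\<^sub>F t in at_right 0. case i of (a, b) \<Rightarrow> a \<bullet> (y + t *\<^sub>R u) \<le> b" if "i \<in> I" for i
      proof -
        obtain a b where i: "i = (a, b)" by force
        have ay: "a \<bullet> y \<le> b" using y(1) P(2) that i by blast
        show ?thesis
        proof (cases "0 < a \<bullet> u")
          case True
          then have "a \<bullet> y < b" using no ay that i by fastforce
          moreover have "((\<lambda>t. a \<bullet> (y + t *\<^sub>R u)) \<longlongrightarrow> a \<bullet> (y + 0 *\<^sub>R u)) (at_right 0)"
            by (intro tendsto_intros)
          ultimately have "\<forall>\<^sub>F t in at_right 0. a \<bullet> (y + t *\<^sub>R u) < b"
            by (intro order_tendstoD(2)) auto
          then show ?thesis by (rule eventually_mono) (auto simp: i)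
        next
          case False
          have "a \<bullet> (y + t *\<^sub>R u) \<le> b" if "0 < t" for t
            using that ay mult_nonneg_nonpos[of t "a \<bullet> u"] False by (simp add: inner_add_right)
          then show ?thesis
            using eventually_at_right_less[of 0] by (auto simp: i elim!: eventually_mono)
        qed
      qed
      then have "\<forall>\<^sub>F t in at_right 0. \<forall>i\<in>I. case i of (a, b) \<Rightarrow> a \<bullet> (y + t *\<^sub>R u) \<le> b"
        using I by (simp add: eventually_ball_finite_distrib)
      moreover have "\<forall>\<^sub>F t in at_right 0. 0 < (t :: real)"
        by (rule eventually_at_right_less)
      ultimately have "\<forall>\<^sub>F t in at_right 0. (\<forall>i\<in>I. case i of (a, b) \<Rightarrow> a \<bullet> (y + t *\<^sub>R u) \<le> b) \<and> 0 < t"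
        by (rule eventually_conj)
      then obtain t :: real where t: "\<forall>i\<in>I. case i of (a, b) \<Rightarrow> a \<bullet> (y + t *\<^sub>R u) \<le> b" "0 < t"
        using eventually_happens'[OF trivial_limit_at_right_real] by blast
      have "y + t *\<^sub>R u \<in> P"
        by (subst P(2)) (use t(1) in blast)
      moreover have "perp_projection u (y + t *\<^sub>R u) = perp_projection u y"
        by (simp add: perp_projection_def inner_add_left algebra_simps)
      ultimately have "(y + t *\<^sub>R u) \<bullet> u \<le> y \<bullet> u"
        using y by auto
      with t(2) show False by (simp add: inner_add_left)
    qed
    then obtain a b where "(a, b) \<in> I" "0 < a \<bullet> u" "a \<bullet> y = b" by blast
    moreover have "z \<in> prism u (P \<inter> {x. a \<bullet> x = b})" if "a \<bullet> y = b" for a b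
      using y(1) z that u by (auto simp: mem_prism_iff)
    ultimately show "z \<in> ?R" by blast
  qed
qed

section \<open>Projection volume as a sum over facets\<close>

text \<open>A line in direction \<open>u\<close> leaves \<open>P\<close> at one point only, so a
  common shadow point comes from a point on both hyperplanes. Eliminating the component along
  \<open>u\<close> from the two equations confines \<open>z\<close> to a hyperplane.\<close>

lemma negligible_prism_facets_Int:
  fixes P :: "'a::euclidean_space set"
  assumes P: "P = {x. \<forall>(a, b)\<in>I. a \<bullet> x \<le> b}" and u: "norm u = 1"
    and a: "(a, b) \<in> I" "norm a = 1" "0 < a \<bullet> u" and a': "(a', b') \<in> I" "norm a' = 1" "0 < a' \<bullet> u"
    and neq: "(a, b) \<noteq> (a', b')"
    and ne: "P \<inter> {x. a \<bullet> x = b} \<noteq> {}" "P \<inter> {x. a' \<bullet> x = b'} \<noteq> {}"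
  shows "negligible (prism u (P \<inter> {x. a \<bullet> x = b}) \<inter> prism u (P \<inter> {x. a' \<bullet> x = b'}))"
proof -
  \<comment> \<open>This combination of the normals is orthogonal to \<open>u\<close>, so
    \<open>c \<bullet> z\<close> depends only on the shadow of \<open>z\<close>.\<close>
  define c where "c = (a' \<bullet> u) *\<^sub>R a - (a \<bullet> u) *\<^sub>R a'"
  have "c \<noteq> 0"
  proof
    assume "c = 0"
    then have eq: "(a' \<bullet> u) *\<^sub>R a = (a \<bullet> u) *\<^sub>R a'" by (simp add: c_def)
    then have "norm ((a' \<bullet> u) *\<^sub>R a) = norm ((a \<bullet> u) *\<^sub>R a')" by simp
    then have "\<bar>a' \<bullet> u\<bar> * norm a = \<bar>a \<bullet> u\<bar> * norm a'" by (simp only: norm_scaleR)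
    then have "a' \<bullet> u = a \<bullet> u" unfolding a(2) a'(2) using a(3) a'(3) by linarith
    then have "a = a'" using eq a(3) by (metis scaleR_cancel_left less_irrefl)
    moreover have "b = b'"
    \<comment> \<open>Both hyperplanes touch \<open>P\<close> and have the same normal, so neither
      offset can exceed the other.\<close>
    proof -
      obtain x y where "x \<in> P" "a \<bullet> x = b" "y \<in> P" "a' \<bullet> y = b'"
        using ne by auto
      moreover have "a' \<bullet> x \<le> b'" "a \<bullet> y \<le> b"
        using a(1) a'(1) \<open>x \<in> P\<close> \<open>y \<in> P\<close> by (auto simp: P)
      ultimately show ?thesis using \<open>a = a'\<close> by simp
    qed
    ultimately show False using neq by simp
  qed
  then have "negligible {z. c \<bullet> z = b * (a' \<bullet> u) - b' * (a \<bullet> u)}"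
    by (simp add: negligible_hyperplane)
  moreover have "prism u (P \<inter> {x. a \<bullet> x = b}) \<inter> prism u (P \<inter> {x. a' \<bullet> x = b'})
    \<subseteq> {z. c \<bullet> z = b * (a' \<bullet> u) - b' * (a \<bullet> u)}"
  proof
    fix z assume "z \<in> prism u (P \<inter> {x. a \<bullet> x = b}) \<inter> prism u (P \<inter> {x. a' \<bullet> x = b'})"
    then obtain x y where x: "x \<in> P" "a \<bullet> x = b" "perp_projection u x = perp_projection u z"
      and y: "y \<in> P" "a' \<bullet> y = b'" "perp_projection u y = perp_projection u z"
      using u by (auto simp: mem_prism_iff)
    have diff: "v = w + (v \<bullet> u - w \<bullet> u) *\<^sub>R u" if "perp_projection u v = perp_projection u w" for v w
      using that u by (simp add: perp_projection_def norm_eq_1 algebra_simps)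
    define s where "s = x \<bullet> u - y \<bullet> u"
    have xy: "x = y + s *\<^sub>R u"
      unfolding s_def using x(3) y(3) by (intro diff) simp
    have "a' \<bullet> x \<le> b'" "a \<bullet> y \<le> b"
      using a(1) a'(1) x(1) y(1) by (auto simp: P)
    \<comment> \<open>\<open>y\<close> maximises \<open>a'\<close> over \<open>P\<close> and
      \<open>x\<close> maximises \<open>a\<close>, which bounds the displacement \<open>s\<close>
      from both sides.\<close>
    then have "s * (a' \<bullet> u) \<le> 0" "0 \<le> s * (a \<bullet> u)"
      using x(2) y(2) by (simp_all add: xy inner_add_right)
    then have "s = 0" using a(3) a'(3)
      by (simp add: mult_le_0_iff zero_le_mult_iff)
    then have "x = y" using xy by simp
    have zx: "z = x + (z \<bullet> u - x \<bullet> u) *\<^sub>R u"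
      using x(3) by (intro diff) simp
    have "c \<bullet> z = c \<bullet> x"
      by (subst zx) (simp add: c_def inner_diff_left inner_add_right)
    also have "\<dots> = b * (a' \<bullet> u) - b' * (a \<bullet> u)"
      using x(2) y(2) \<open>x = y\<close> by (simp add: c_def inner_diff_left)
    finally show "z \<in> {z. c \<bullet> z = b * (a' \<bullet> u) - b' * (a \<bullet> u)}" by simp
  qed
  ultimately show ?thesis by (rule negligible_subset)
qed

text \<open>The prism splits into prisms over the facets facing \<open>u\<close>, overlapping in
  null sets, and each has the facet volume scaled by \<open>a \<bullet> u\<close>. The weights
  \<open>measure lebesgue (prism a ...)\<close> are the facet volumes, independent of
  \<open>u\<close>.\<close>

lemma projection_volume_polytope:
  fixes P :: "'a::euclidean_space set"
  assumes P: "compact P" "P = {x. \<forall>(a, b)\<in>I. a \<bullet> x \<le> b}" and I: "finite I"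
    and norm: "\<And>a b. (a, b) \<in> I \<Longrightarrow> norm a = 1"
    and ne: "\<And>a b. (a, b) \<in> I \<Longrightarrow> P \<inter> {x. a \<bullet> x = b} \<noteq> {}"
    and u: "norm u = 1"
  shows "projection_volume P u =
    (\<Sum>(a, b)\<in>{(a, b) \<in> I. 0 < a \<bullet> u}. measure lebesgue (prism a (P \<inter> {x. a \<bullet> x = b})) * (a \<bullet> u))"
proof -
  let ?J = "{(a, b) \<in> I. 0 < a \<bullet> u}"
  let ?f = "\<lambda>(a, b). P \<inter> {x. a \<bullet> x = b}"
  have cf: "compact (?f i)" for i
    using P(1) by (auto simp: case_prod_unfold intro!: compact_Int_closed closed_hyperplane)
  have "projection_volume P u = measure lebesgue (\<Union>i\<in>?J. prism u (?f i))"
    unfolding projection_volume_eq_measure_prism[OF u P(1)] prism_polytope_eq_Union[OF P I u]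
    by (simp add: case_prod_unfold)
  also have "\<dots> = (\<Sum>i\<in>?J. measure lebesgue (prism u (?f i)))"
  proof (rule measure_negligible_finite_Union_image)
    show "finite ?J" using I by (rule rev_finite_subset) auto
    show "prism u (?f i) \<in> lmeasurable" for i
      by (intro lmeasurable_compact compact_prism cf)
    show "pairwise (\<lambda>i j. negligible (prism u (?f i) \<inter> prism u (?f j))) ?J"
    proof (rule pairwiseI)
      fix i j assume ij: "i \<in> ?J" "j \<in> ?J" "i \<noteq> j"
      obtain a b a' b' where [simp]: "i = (a, b)" "j = (a', b')" by force
      show "negligible (prism u (?f i) \<inter> prism u (?f j))"
        using negligible_prism_facets_Int[OF P(2) u, of a b a' b'] ij norm ne by auto
    qed
  qed
  also have "\<dots> = (\<Sum>i\<in>?J. case i of (a, b) \<Rightarrow> measure lebesgue (prism a (P \<inter> {x. a \<bullet> x = b})) * (a \<bullet> u))"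
  proof (rule sum.cong)
    fix i assume i: "i \<in> ?J"
    obtain a b where [simp]: "i = (a, b)" by force
    have "measure lebesgue (prism u (?f i)) = \<bar>a \<bullet> u\<bar> * measure lebesgue (prism a (?f i))"
      using i norm u by (intro measure_prism_hyperplane[where b = b] cf) auto
    then show "measure lebesgue (prism u (?f i)) =
      (case i of (a, b) \<Rightarrow> measure lebesgue (prism a (P \<inter> {x. a \<bullet> x = b})) * (a \<bullet> u))"
      using i by (simp add: mult.commute)
  qed simp
  finally show ?thesis .
qed

section \<open>Local linearity of the projection volume\<close>

text \<open>No facet normal is orthogonal to \<open>u\<close>, so by continuity the finite set of
  facets facing \<open>v\<close> is constant for \<open>v\<close> near \<open>u\<close>. The sum
  over facets then has a fixed index set.\<close>

lemma projection_volume_locally_linear: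
  fixes P :: "'a::euclidean_space set"
  assumes P: "polytope P" "interior P \<noteq> {}" and u: "\<not> parallel_to_facet_of u P"
  obtains w where "\<forall>\<^sub>F v in nhds u. norm v = 1 \<longrightarrow> projection_volume P v = w \<bullet> v"
proof -
  from polytope_facet_inequalities[OF P] obtain I :: "('a \<times> real) set" where I: "finite I"
    "\<forall>(a, b)\<in>I. norm a = 1" "P = {x. \<forall>(a, b)\<in>I. a \<bullet> x \<le> b}"
    "\<forall>(a, b)\<in>I. P \<inter> {x. a \<bullet> x = b} facet_of P" .
  then have I: "finite I" "\<And>a b. (a, b) \<in> I \<Longrightarrow> norm a = 1"
    "P = {x. \<forall>(a, b)\<in>I. a \<bullet> x \<le> b}"
    "\<And>a b. (a, b) \<in> I \<Longrightarrow> P \<inter> {x. a \<bullet> x = b} facet_of P"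
    by blast+
  have ne: "P \<inter> {x. a \<bullet> x = b} \<noteq> {}" if "(a, b) \<in> I" for a b
    using I(4)[OF that] by (auto simp: facet_of_def)
  have nz: "a \<bullet> u \<noteq> 0" if "(a, b) \<in> I" for a b
  proof -
    have "a \<noteq> 0" using I(2)[OF that] by auto
    then have "normal_vector_of a (P \<inter> {x. a \<bullet> x = b})"
      using affine_hull_facet_in_hyperplane[OF P(2) I(4)[OF that], of a b]
      by (auto simp: normal_vector_of_def)
    with u I(4)[OF that] show ?thesis
      by (auto simp: parallel_to_facet_of_def orthogonal_def)
  qed
  let ?c = "\<lambda>(a, b). measure lebesgue (prism a (P \<inter> {x. a \<bullet> x = b}))"
  \<comment> \<open>The sum of the unit normals of the facets facing \<open>u\<close>, weighted by
    facet volume.\<close>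
  define w where "w = (\<Sum>i\<in>{(a, b) \<in> I. 0 < a \<bullet> u}. ?c i *\<^sub>R fst i)"
  have "\<forall>\<^sub>F v in nhds u. 0 < fst i \<bullet> v \<longleftrightarrow> 0 < fst i \<bullet> u" if "i \<in> I" for i
  proof -
    obtain a b where i: "i = (a, b)" by force
    have lim: "((\<lambda>v. a \<bullet> v) \<longlongrightarrow> a \<bullet> u) (nhds u)"
      by (intro tendsto_intros filterlim_ident)
    have "a \<bullet> u \<noteq> 0" using nz that i by auto
    then consider "0 < a \<bullet> u" | "a \<bullet> u < 0" by linarith
    then show ?thesis
    proof cases
      case 1
      then show ?thesis using order_tendstoD(1)[OF lim, of 0] by (auto simp: i elim!: eventually_mono)
    next
      case 2
      then show ?thesis using order_tendstoD(2)[OF lim, of 0] by (auto simp: i elim!: eventually_mono)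
    qed
  qed
  then have "\<forall>\<^sub>F v in nhds u. \<forall>i\<in>I. 0 < fst i \<bullet> v \<longleftrightarrow> 0 < fst i \<bullet> u"
    using I(1) by (simp add: eventually_ball_finite_distrib)
  then have "\<forall>\<^sub>F v in nhds u. norm v = 1 \<longrightarrow> projection_volume P v = w \<bullet> v"
  proof (rule eventually_mono, intro impI)
    fix v assume v: "\<forall>i\<in>I. 0 < fst i \<bullet> v \<longleftrightarrow> 0 < fst i \<bullet> u" "norm v = 1"
    have "{(a, b) \<in> I. 0 < a \<bullet> v} = {(a, b) \<in> I. 0 < a \<bullet> u}"
      using v(1) by fastforce
    moreover have "projection_volume P v =
        (\<Sum>(a, b)\<in>{(a, b) \<in> I. 0 < a \<bullet> v}. measure lebesgue (prism a (P \<inter> {x. a \<bullet> x = b})) * (a \<bullet> v))"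
      using P(1) by (intro projection_volume_polytope I ne v(2) polytope_imp_compact)
    ultimately show "projection_volume P v = w \<bullet> v"
      by (simp add: w_def inner_sum_left case_prod_unfold)
  qed
  then show ?thesis by (rule that)
qed

subsection \<open>Rotating two vectors of a frame\<close>

text \<open>Frames are sets, so the two non-membership claims serve to split off the factors of
  \<open>x\<close> and \<open>y\<close> in a product over the new frame.\<close>

lemma frame_rotate:
  fixes F :: "'a::euclidean_space set"
  assumes F: "frame F" and uv: "u \<in> F" "v \<in> F" "u \<noteq> v" and c: "c\<^sup>2 + s\<^sup>2 = 1"
  defines "x \<equiv> c *\<^sub>R u + s *\<^sub>R v" and "y \<equiv> c *\<^sub>R v - s *\<^sub>R u"
  shows "norm x = 1" "norm y = 1" "frame (insert x (insert y (F - {u, v})))"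
    "x \<notin> insert y (F - {u, v})" "y \<notin> F - {u, v}"
proof -
  note inner = frameD(4)[OF F]
  have [simp]: "u \<bullet> u = 1" "v \<bullet> v = 1" "u \<bullet> v = 0" "v \<bullet> u = 0"
    using inner uv by auto
  have rest [simp]: "u \<bullet> w = 0" "v \<bullet> w = 0" "w \<bullet> w = 1" if "w \<in> F - {u, v}" for w
    using inner uv that by auto
  have c': "c * c + s * s = 1" using c by (simp add: power2_eq_square)
  have xy [simp]: "x \<bullet> x = 1" "y \<bullet> y = 1" "x \<bullet> y = 0"
    using c' by (simp_all add: x_def y_def inner_add_left inner_diff_left inner_add_right inner_diff_right algebra_simps)
  have xw: "x \<bullet> w = 0" "y \<bullet> w = 0" if "w \<in> F - {u, v}" for w
    using that by (simp_all add: x_def y_def inner_add_left inner_diff_left)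
  show "norm x = 1" "norm y = 1"
    by (simp_all add: norm_eq_1)
  have "x \<noteq> y" using xy(1,3) by (metis zero_neq_one)
  then show "x \<notin> insert y (F - {u, v})" "y \<notin> F - {u, v}"
    using xw[of x] xw[of y] \<open>x \<noteq> y\<close> by auto
  let ?G = "insert x (insert y (F - {u, v}))"
  \<comment> \<open>The inverse rotation recovers \<open>u\<close> and \<open>v\<close>, so the new
    set still spans.\<close>
  have "u = c *\<^sub>R x - s *\<^sub>R y" "v = s *\<^sub>R x + c *\<^sub>R y"
    using c' by (simp_all add: x_def y_def algebra_simps flip: scaleR_left_distrib)
  moreover have "c *\<^sub>R x - s *\<^sub>R y \<in> span ?G" "s *\<^sub>R x + c *\<^sub>R y \<in> span ?G"
    by (intro span_add span_diff span_scale span_base; simp)+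
  ultimately have "F \<subseteq> span ?G"
    by (auto intro: span_base)
  then have "span ?G = UNIV"
    using span_minimal[OF _ subspace_span, of F ?G] frameD(3)[OF F] by auto
  moreover have "pairwise orthogonal ?G"
    using F xw xy by (auto simp: frame_def orthonormal_basis_def pairwise_insert orthogonal_def inner_commute
        intro: pairwise_subset)
  moreover have "\<forall>b\<in>?G. norm b = 1"
    using \<open>norm x = 1\<close> \<open>norm y = 1\<close> F by (auto simp: frame_def orthonormal_basis_def)
  ultimately show "frame ?G"
    by (simp add: frame_def orthonormal_basis_def)
qed

text \<open>The derivative at 0 gives the first-order condition. With it the product equals
  \<open>A * C + (B * D - A * C) * (sin t)\<^sup>2\<close> exactly, so one small
  \<open>t > 0\<close> replaces a second-derivative test.\<close>

lemma rotated_product_not_local_min: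
  fixes A B C D :: real
  assumes "A > 0" "C > 0"
    and min: "\<forall>\<^sub>F t in nhds 0. A * C \<le> (A * cos t + B * sin t) * (C * cos t + D * sin t)"
  shows False
proof -
  let ?f = "\<lambda>t. (A * cos t + B * sin t) * (C * cos t + D * sin t)"
  have d: "(?f has_real_derivative A * D + B * C) (at 0)"
    by (auto intro!: derivative_eq_intros)
  obtain e where e: "e > 0" "\<And>t. \<bar>t\<bar> < e \<Longrightarrow> A * C \<le> ?f t"
    using min unfolding eventually_nhds_metric by (auto simp: dist_real_def)
  have E: "A * D + B * C = 0"
    using DERIV_local_min[OF d e(1)] e(2) by simp
  define t where "t = min (e / 2) 1"
  have t: "0 < t" "t < e" "t < pi"
    using e(1) pi_gt3 by (auto simp: t_def)
  have "sin t > 0" using t by (intro sin_gt_zero) auto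
  have "A * C \<le> ?f t" using t e(2)[of t] by auto
  also have "?f t = A * C * (cos t)\<^sup>2 + (A * D + B * C) * sin t * cos t + B * D * (sin t)\<^sup>2"
    by (simp add: algebra_simps power2_eq_square)
  also have "(cos t)\<^sup>2 = 1 - (sin t)\<^sup>2" by (simp add: cos_squared_eq)
  finally have "0 \<le> (B * D - A * C) * (sin t)\<^sup>2"
    using E by (simp add: algebra_simps)
  then have "A * C \<le> B * D"
    using \<open>sin t > 0\<close> by (simp add: zero_le_mult_iff)
  moreover have "A * C > 0" using assms by simp
  ultimately have "0 < (A * C) * (B * D)" by simp
  \<comment> \<open>The first-order condition reads \<open>B * C = - (A * D)\<close>, and
    \<open>(A * C) * (B * D) = (A * D) * (B * C)\<close>.\<close>
  also have "\<dots> = - (A * D)\<^sup>2"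
    using E by (simp add: power2_eq_square algebra_simps) (metis add_eq_0_iff mult.commute mult.left_commute mult_minus_right)
  finally show False by (simp add: not_less[symmetric])
qed

text \<open>Rotating \<open>u\<close> and \<open>v\<close> produces competing frames, and the
  factors of the remaining vectors cancel. Optimality thus makes the product of two locally linear
  volumes minimal at angle 0, which is impossible.\<close>

lemma best_frame_non_parallel_unique:
  fixes P :: "'a::euclidean_space set"
  assumes P: "polytope P" "interior P \<noteq> {}" and F: "best_frame P F"
    and u: "u \<in> F" "\<not> parallel_to_facet_of u P" and v: "v \<in> F" "\<not> parallel_to_facet_of v P"
  shows "u = v"
proof (rule ccontr)
  assume "u \<noteq> v"
  have fr: "frame F" and best: "\<And>G. frame G \<Longrightarrow> Psi P F \<le> Psi P G"
    using F by (auto simp: best_frame_def)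
  let ?h = "projection_volume P"
  have norm: "norm w = 1" if "w \<in> F" for w
    using fr that by (auto simp: frame_def orthonormal_basis_def)
  have pos: "0 < ?h w" if "norm w = 1" for w
    using that P by (simp add: projection_volume_eq_measure_prism measure_prism_pos polytope_imp_compact
        del: measure_completion)
  obtain a where a: "\<forall>\<^sub>F x in nhds u. norm x = 1 \<longrightarrow> ?h x = a \<bullet> x"
    by (rule projection_volume_locally_linear[OF P u(2)])
  obtain b where b: "\<forall>\<^sub>F x in nhds v. norm x = 1 \<longrightarrow> ?h x = b \<bullet> x"
    by (rule projection_volume_locally_linear[OF P v(2)])
  have ha: "?h u = a \<bullet> u" and hb: "?h v = b \<bullet> v"
    using eventually_nhds_x_imp_x[OF a] eventually_nhds_x_imp_x[OF b] norm u v by auto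
  let ?x = "\<lambda>t. cos t *\<^sub>R u + sin t *\<^sub>R v" and ?y = "\<lambda>t. cos t *\<^sub>R v - sin t *\<^sub>R u"
  let ?R = "F - {u, v}"
  have finF: "finite F" using frameD(1)[OF fr] .
  have "(?x \<longlongrightarrow> ?x 0) (nhds 0)" "(?y \<longlongrightarrow> ?y 0) (nhds 0)"
    by (intro tendsto_intros filterlim_ident)+
  then have lim: "filterlim ?x (nhds u) (nhds 0)" "filterlim ?y (nhds v) (nhds 0)"
    by simp_all
  \<comment> \<open>The sign of \<open>b \<bullet> u\<close> is negative because \<open>v\<close>
    turns towards \<open>- u\<close> while \<open>u\<close> turns towards \<open>v\<close>.\<close>
  have "\<forall>\<^sub>F t in nhds 0. ?h u * ?h v \<le>
     (?h u * cos t + (a \<bullet> v) * sin t) * (?h v * cos t + (- (b \<bullet> u)) * sin t)"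
    using eventually_compose_filterlim[OF a lim(1)] eventually_compose_filterlim[OF b lim(2)]
  proof eventually_elim
    case (elim t)
    note rot = frame_rotate[OF fr u(1) v(1) \<open>u \<noteq> v\<close>, of "cos t" "sin t", simplified]
    have "Psi P F = ?h u * ?h v * (\<Prod>w\<in>?R. ?h w)"
    proof -
      have "F = insert u (insert v ?R)" using u v by auto
      then have "Psi P F = (\<Prod>w\<in>insert u (insert v ?R). ?h w)" by (simp add: Psi_def)
      then show ?thesis using finF \<open>u \<noteq> v\<close> by simp
    qed
    moreover have "Psi P (insert (?x t) (insert (?y t) ?R)) = ?h (?x t) * ?h (?y t) * (\<Prod>w\<in>?R. ?h w)"
      unfolding Psi_def using finF rot(4,5) by (subst prod.insert; simp)+
    \<comment> \<open>Strict positivity of the common factor permits its cancellation from the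
      inequality.\<close>
    moreover have "0 < (\<Prod>w\<in>?R. ?h w)"
      by (intro prod_pos) (auto intro: pos norm)
    ultimately have "?h u * ?h v \<le> ?h (?x t) * ?h (?y t)"
      using best[OF rot(3)] by simp
    also have "?h (?x t) = ?h u * cos t + (a \<bullet> v) * sin t"
      using elim(1) rot(1) by (simp add: ha inner_add_right mult.commute)
    also have "?h (?y t) = ?h v * cos t + (- (b \<bullet> u)) * sin t"
      using elim(2) rot(2) by (simp add: hb inner_diff_right mult.commute)
    finally show ?case .
  qed
  then show False
    by (rule rotated_product_not_local_min[rotated 2]) (auto intro: pos norm u v)
qed

theorem theorem1:
  fixes P F :: "(real ^ 'n) set"
  assumes "CARD('n) \<ge> 2"
    and "polytope P"
    and "interior P \<noteq> {}"
    and "best_frame P F"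
  shows "card {u \<in> F. parallel_to_facet_of u P} \<ge> CARD('n) - 1"
proof -
  let ?N = "{u \<in> F. \<not> parallel_to_facet_of u P}"
  have F: "finite F" "card F = CARD('n)"
    using assms(4) frameD(1,2)[of F] by (auto simp: best_frame_def)
  have "card ?N \<le> Suc 0"
    using best_frame_non_parallel_unique[OF assms(2-4)] F(1) by (subst card_le_Suc0_iff_eq) auto
  moreover have "{u \<in> F. parallel_to_facet_of u P} = F - ?N" by auto
  ultimately show ?thesis
    using F by (simp add: card_Diff_subset)
qed

end
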